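(* Let $D\subset\mathbb{R}^2$ be open and let $f,\nu:D\to\mathbb{R}^4\setminus\{0\}$ be smooth with $\langle f,\nu\rangle=0$, related by the elliptic projective Lelieuvre map, i.e. $f\wedge f_x=-\star(\nu\wedge\nu_y)$ and $f\wedge f_y=\star(\nu\wedge\nu_x)$ on $D$. Assume that $\nu,\nu_x,\nu_y$ are linearly independent at every point of $D$. Then there exist functions $U,V,W,C,\tilde U,\tilde V,\tilde W,\tilde C:D\to\mathbb{R}$ such that $$\nu_{xy}=U\nu_x+V\nu_y+W\nu,\qquad \nu_{yy}-\nu_{xx}=-2\tilde V\nu_x+2\tilde U\nu_y+C\nu$$ and $$f_{xy}=\tilde Uf_x+\tilde Vf_y+\tilde Wf,\qquad f_{yy}-f_{xx}=-2Vf_x+2Uf_y+\tilde Cf.$$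
   Context: $f=(f_1,\dots,f_4)$ and $\nu=(\nu_1,\dots,\nu_4)$ are homogeneous coordinate vectors of surfaces in $P^3$ and in the dual space $P_3$, depending on real variables $(x,y)$; subscripts $x,y$ denote partial derivatives; $\langle f,\nu\rangle=\sum_i f_i\nu_i$. $\varepsilon$ is the totally alternating symbol with $\varepsilon_{1234}=1$. For $a,b\in\mathbb{R}^4$, $(a\wedge b)_{ik}=a_ib_k-a_kb_i$; for a skew-symmetric $T$, $(\star T)_{ik}=\frac12\sum_{l,m}\varepsilon_{lmik}T_{lm}$. Thus the equations of the map read $f_if_{k,x}-f_kf_{i,x}=-\sum_{l,m}\varepsilon_{iklm}\nu_l\nu_{m,y}$ and $f_if_{k,y}-f_kf_{i,y}=\sum_{l,m}\varepsilon_{iklm}\nu_l\nu_{m,x}$ for $i,k=1,\dots,4$. *)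

theory Defs
  imports "HOL-Analysis.Analysis"
begin

definition partial_x :: "(real \<times> real \<Rightarrow> 'a::real_normed_vector) \<Rightarrow> real \<times> real \<Rightarrow> 'a" where
  "partial_x f p = vector_derivative (\<lambda>s. f (s, snd p)) (at (fst p))"

definition partial_y :: "(real \<times> real \<Rightarrow> 'a::real_normed_vector) \<Rightarrow> real \<times> real \<Rightarrow> 'a" where
  "partial_y f p = vector_derivative (\<lambda>t. f (fst p, t)) (at (snd p))"

(* Class C^k on an open set D.  On open D, being differentiable with C^k partial
   derivatives is the usual notion of class C^(k+1). *)
fun Ck_on :: "nat \<Rightarrow> (real \<times> real) set \<Rightarrow> (real \<times> real \<Rightarrow> 'a::real_normed_vector) \<Rightarrow> bool" where
  "Ck_on 0 D f \<longleftrightarrow> continuous_on D f"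
| "Ck_on (Suc k) D f \<longleftrightarrow>
     f differentiable_on D \<and> Ck_on k D (partial_x f) \<and> Ck_on k D (partial_y f)"

definition smooth_on :: "(real \<times> real) set \<Rightarrow> (real \<times> real \<Rightarrow> 'a::real_normed_vector) \<Rightarrow> bool" where
  "smooth_on D f \<longleftrightarrow> (\<forall>k. Ck_on k D f)"

(* The sign of the map 1 |-> i, 2 |-> k, 3 |-> l, 4 |-> m if it is a permutation
   of the four indices, and 0 otherwise. *)
definition eps :: "4 \<Rightarrow> 4 \<Rightarrow> 4 \<Rightarrow> 4 \<Rightarrow> real" where
  "eps i k l m =
     (let s = (\<lambda>j::4. if j = 1 then i else if j = 2 then k else if j = 3 then l else m)
      in if s permutes UNIV then of_int (sign s) else 0)"

lemma eps_1234: "eps 1 2 3 4 = 1"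
proof -
  have "(\<lambda>j::4. if j = 1 then 1 else if j = 2 then 2 else if j = 3 then 3 else 4) = id"
    using exhaust_4 by fastforce
  then show ?thesis
    by (simp add: eps_def sign_id permutes_id)
qed

definition wedge :: "real ^ 4 \<Rightarrow> real ^ 4 \<Rightarrow> real ^ 4 ^ 4" where
  "wedge a b = (\<chi> i k. a $ i * b $ k - a $ k * b $ i)"

definition star :: "real ^ 4 ^ 4 \<Rightarrow> real ^ 4 ^ 4" where
  "star T = (\<chi> i k. 1 / 2 * (\<Sum>l\<in>UNIV. \<Sum>m\<in>UNIV. eps l m i k * T $ l $ m))"

definition elliptic_lelieuvre ::
  "(real \<times> real) set \<Rightarrow> (real \<times> real \<Rightarrow> real ^ 4) \<Rightarrow> (real \<times> real \<Rightarrow> real ^ 4) \<Rightarrow> bool" where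
  "elliptic_lelieuvre D f \<nu> \<longleftrightarrow>
     (\<forall>p\<in>D. wedge (f p) (partial_x f p) = - star (wedge (\<nu> p) (partial_y \<nu> p)) \<and>
             wedge (f p) (partial_y f p) = star (wedge (\<nu> p) (partial_x \<nu> p)))"

end

(* Contracting the two equations of the map with nu, nu_x, nu_y shows that f is orthogonal to
   nu, nu_x, nu_y and that nu is orthogonal to f, f_x, f_y; moreover <f_x, nu_y> = <f_y, nu_x> = 0.
   Differentiating <f, nu_x> = 0 and <f_x, nu> = 0 in y then puts nu_xy in the span of nu, nu_x, nu_y
   and f_xy in the span of f, f_x, f_y, which gives the coefficients U, V, W and U', V', W'.
   Cross-differentiating the equations and using the symmetry of mixed partials yields
     2 f ^ f_xy = *(nu ^ (nu_xx - nu_yy))   and   f ^ (f_yy - f_xx) = 2 *(nu ^ nu_xy).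
   Expanding f_xy and nu_xy here and applying the map once more gives the two remaining equations
   modulo nu and f, respectively. *)

theory Submission
  imports Defs
begin

section \<open>Mixed partial derivatives\<close>

text \<open>Mean value theorem twice: first in s for the increment of \<open>g\<close> across the
  square in t, then in t for \<open>gx\<close>. Only one order of differentiation enters, so
  exchanging the variables serves the other order.\<close>

lemma second_difference_mvt:
  fixes g gx gxy :: "real \<Rightarrow> real \<Rightarrow> real"
  assumes "h > 0"
    and gx: "\<And>s t. s \<in> {a..a+h} \<Longrightarrow> t \<in> {b..b+h} \<Longrightarrow> ((\<lambda>s. g s t) has_real_derivative gx s t) (at s)"
    and gxy: "\<And>s t. s \<in> {a..a+h} \<Longrightarrow> t \<in> {b..b+h} \<Longrightarrow> ((\<lambda>t. gx s t) has_real_derivative gxy s t) (at t)"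
  obtains s t where "s \<in> {a..a+h}" "t \<in> {b..b+h}"
    "g (a+h) (b+h) - g (a+h) b - g a (b+h) + g a b = h * h * gxy s t"
proof -
  have "\<exists>s>a. s < a+h \<and> (g (a+h) (b+h) - g (a+h) b) - (g a (b+h) - g a b)
      = (a+h-a) * (gx s (b+h) - gx s b)"
    by (rule MVT2) (use \<open>h > 0\<close> in \<open>auto intro!: DERIV_diff gx\<close>)
  then obtain s where s: "a < s" "s < a+h"
    "(g (a+h) (b+h) - g (a+h) b) - (g a (b+h) - g a b) = h * (gx s (b+h) - gx s b)"
    by auto
  have "\<exists>t>b. t < b+h \<and> gx s (b+h) - gx s b = (b+h-b) * gxy s t"
    by (rule MVT2) (use \<open>h > 0\<close> s in \<open>auto intro!: gxy\<close>)
  then obtain t where t: "b < t" "t < b+h" "gx s (b+h) - gx s b = h * gxy s t"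
    by auto
  show thesis
    by (rule that[of s t]) (use s t in \<open>auto simp: algebra_simps\<close>)
qed

text \<open>The second difference over a square is symmetric in the two variables, so it is h^2
  times a value of \<open>gxy\<close> and also h^2 times a value of \<open>gyx\<close>. If these
  differed at \<open>p\<close>, continuity would keep them apart on a small square.\<close>

lemma mixed_partials_eq_real:
  fixes g gx gy gxy gyx :: "real \<times> real \<Rightarrow> real"
  assumes "open D" and p: "p \<in> D"
    and gx: "\<And>s t. (s, t) \<in> D \<Longrightarrow> ((\<lambda>s. g (s, t)) has_real_derivative gx (s, t)) (at s)"
    and gy: "\<And>s t. (s, t) \<in> D \<Longrightarrow> ((\<lambda>t. g (s, t)) has_real_derivative gy (s, t)) (at t)"
    and gxy: "\<And>s t. (s, t) \<in> D \<Longrightarrow> ((\<lambda>t. gx (s, t)) has_real_derivative gxy (s, t)) (at t)"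
    and gyx: "\<And>s t. (s, t) \<in> D \<Longrightarrow> ((\<lambda>s. gy (s, t)) has_real_derivative gyx (s, t)) (at s)"
    and cont: "continuous_on D gxy" "continuous_on D gyx"
  shows "gxy p = gyx p"
proof (rule ccontr)
  assume ne: "gxy p \<noteq> gyx p"
  \<comment> \<open>Half the gap: no number is within \<open>e\<close> of both mixed partials at
    \<open>p\<close>.\<close>
  define e where "e = dist (gxy p) (gyx p) / 2"
  have "e > 0" using ne by (simp add: e_def)
  obtain a b where ab: "p = (a, b)" by fastforce
  have "(gxy \<longlongrightarrow> gxy p) (nhds p)" "(gyx \<longlongrightarrow> gyx p) (nhds p)"
    using cont p \<open>open D\<close> by (simp_all add: continuous_on_eq_continuous_at isCont_def tendsto_at_iff_tendsto_nhds)
  then have "\<forall>\<^sub>F q in nhds p. dist (gxy q) (gxy p) < e" "\<forall>\<^sub>F q in nhds p. dist (gyx q) (gyx p) < e"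
    using \<open>e > 0\<close> by (simp_all add: tendstoD)
  moreover have "\<forall>\<^sub>F q in nhds p. q \<in> D"
    using \<open>open D\<close> p by (simp add: eventually_nhds_in_open)
  ultimately have "\<forall>\<^sub>F q in nhds p. q \<in> D \<and> dist (gxy q) (gxy p) < e \<and> dist (gyx q) (gyx p) < e"
    by (simp add: eventually_conj_iff)
  then obtain d where d: "d > 0" "\<And>q. dist q p < d \<Longrightarrow>
      q \<in> D \<and> dist (gxy q) (gxy p) < e \<and> dist (gyx q) (gyx p) < e"
    by (auto simp: eventually_nhds_metric)
  \<comment> \<open>Points of the square of side \<open>h\<close> at \<open>p\<close> are within 2h
    < d of \<open>p\<close>.\<close>
  define h where "h = d / 3"
  have "h > 0" using d by (simp add: h_def)
  have near: "(s, t) \<in> D \<and> dist (gxy (s, t)) (gxy p) < e \<and> dist (gyx (s, t)) (gyx p) < e"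
    if "s \<in> {a..a+h}" "t \<in> {b..b+h}" for s t
  proof (rule d)
    have "dist (s, t) p \<le> \<bar>s - a\<bar> + \<bar>t - b\<bar>"
      by (simp add: ab dist_Pair_Pair dist_real_def sqrt_sum_squares_le_sum_abs)
    also have "\<dots> < d" using that d by (auto simp: h_def)
    finally show "dist (s, t) p < d" .
  qed
  obtain s t where st: "s \<in> {a..a+h}" "t \<in> {b..b+h}"
    "g (a+h, b+h) - g (a+h, b) - g (a, b+h) + g (a, b) = h * h * gxy (s, t)"
    by (rule second_difference_mvt[of h a b "\<lambda>s t. g (s, t)" "\<lambda>s t. gx (s, t)" "\<lambda>s t. gxy (s, t)"])
       (use \<open>h > 0\<close> near gx gxy in auto)
  \<comment> \<open>The same second difference, with the two variables exchanged.\<close>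
  obtain s' t' where st': "s' \<in> {a..a+h}" "t' \<in> {b..b+h}"
    "g (a+h, b+h) - g (a, b+h) - g (a+h, b) + g (a, b) = h * h * gyx (s', t')"
    by (rule second_difference_mvt[of h b a "\<lambda>t s. g (s, t)" "\<lambda>t s. gy (s, t)" "\<lambda>t s. gyx (s, t)"])
       (use \<open>h > 0\<close> near gy gyx in auto)
  have "h * h * gxy (s, t) = h * h * gyx (s', t')"
    using st st' by linarith
  then have "gxy (s, t) = gyx (s', t')"
    using \<open>h > 0\<close> by simp
  then have "dist (gxy (s, t)) (gxy p) < e" "dist (gxy (s, t)) (gyx p) < e"
    using near[OF st(1,2)] near[OF st'(1,2)] by simp_all
  then show False
    using dist_triangle_half_r[of "gxy (s, t)" "gxy p" "dist (gxy p) (gyx p)" "gyx p"]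
    by (simp add: e_def)
qed

section \<open>Rules for partial derivatives of vector-valued functions\<close>

lemma has_vector_derivative_partial_x:
  assumes "g differentiable at (s, t)"
  shows "((\<lambda>s. g (s, t)) has_vector_derivative partial_x g (s, t)) (at s)"
proof -
  have "(g \<circ> (\<lambda>s. (s, t))) differentiable at s"
    by (rule differentiable_chain_at) (use assms in \<open>auto intro!: derivative_intros\<close>)
  then show ?thesis
    by (simp add: partial_x_def o_def vector_derivative_works)
qed

lemma has_vector_derivative_partial_y:
  assumes "g differentiable at (s, t)"
  shows "((\<lambda>t. g (s, t)) has_vector_derivative partial_y g (s, t)) (at t)"
proof -
  have "(g \<circ> (\<lambda>t. (s, t))) differentiable at t"
    by (rule differentiable_chain_at) (use assms in \<open>auto intro!: derivative_intros\<close>)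
  then show ?thesis
    by (simp add: partial_y_def o_def vector_derivative_works)
qed

text \<open>Pairing with basis vectors reduces this to the scalar case; class C^2 supplies the
  derivatives and the continuity of both mixed partials.\<close>

lemma partial_x_partial_y:
  fixes g :: "real \<times> real \<Rightarrow> 'a::euclidean_space"
  assumes g: "Ck_on (Suc (Suc 0)) D g" and "open D" and "p \<in> D"
  shows "partial_x (partial_y g) p = partial_y (partial_x g) p"
proof (rule euclidean_eqI)
  fix i :: 'a
  have diff: "g differentiable at q" "partial_x g differentiable at q" "partial_y g differentiable at q"
    if "q \<in> D" for q
    using g that differentiable_on_eq_differentiable_at[OF \<open>open D\<close>] by auto
  note deriv = has_vector_derivative_partial_x[THEN
      bounded_linear.has_vector_derivative[OF bounded_linear_inner_left]]
    has_vector_derivative_partial_y[THEN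
      bounded_linear.has_vector_derivative[OF bounded_linear_inner_left]]
  show "partial_x (partial_y g) p \<bullet> i = partial_y (partial_x g) p \<bullet> i"
    by (rule sym, rule mixed_partials_eq_real[where g = "\<lambda>q. g q \<bullet> i" and gx = "\<lambda>q. partial_x g q \<bullet> i"
          and gy = "\<lambda>q. partial_y g q \<bullet> i" and gxy = "\<lambda>q. partial_y (partial_x g) q \<bullet> i"
          and gyx = "\<lambda>q. partial_x (partial_y g) q \<bullet> i" and D = D])
       (use g \<open>open D\<close> \<open>p \<in> D\<close> in \<open>auto simp: has_real_derivative_iff_has_vector_derivative
          intro!: deriv diff continuous_intros\<close>)
qed

text \<open>Near \<open>p\<close> the horizontal line through \<open>p\<close> stays in the open set
  \<open>D\<close>. This permits differentiating identities known only on \<open>D\<close>.\<close>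

lemma partial_x_cong:
  assumes "open D" "p \<in> D" "\<forall>q\<in>D. g q = h q"
  shows "partial_x g p = partial_x h p"
proof -
  have "((\<lambda>s. (s, snd p)) \<longlongrightarrow> (fst p, snd p)) (nhds (fst p))"
    by (intro tendsto_intros filterlim_ident)
  then have "\<forall>\<^sub>F s in nhds (fst p). (s, snd p) \<in> D"
    using topological_tendstoD[OF _ assms(1)] assms(2) by fastforce
  then have "\<forall>\<^sub>F s in nhds (fst p). s \<in> UNIV \<longrightarrow> g (s, snd p) = h (s, snd p)"
    by eventually_elim (simp add: assms(3))
  then show ?thesis
    unfolding partial_x_def by (intro vector_derivative_cong_eq) auto
qed

lemma partial_y_cong:
  assumes "open D" "p \<in> D" "\<forall>q\<in>D. g q = h q"
  shows "partial_y g p = partial_y h p"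
proof -
  have "((\<lambda>t. (fst p, t)) \<longlongrightarrow> (fst p, snd p)) (nhds (snd p))"
    by (intro tendsto_intros filterlim_ident)
  then have "\<forall>\<^sub>F t in nhds (snd p). (fst p, t) \<in> D"
    using topological_tendstoD[OF _ assms(1)] assms(2) by fastforce
  then have "\<forall>\<^sub>F t in nhds (snd p). t \<in> UNIV \<longrightarrow> g (fst p, t) = h (fst p, t)"
    by eventually_elim (simp add: assms(3))
  then show ?thesis
    unfolding partial_y_def by (intro vector_derivative_cong_eq) auto
qed

text \<open>One product rule for the inner product, the wedge and the starred wedge.\<close>

lemma (in bounded_bilinear) partial_x:
  assumes "a differentiable at p" "b differentiable at p"
  shows "partial_x (\<lambda>q. prod (a q) (b q)) p = prod (a p) (partial_x b p) + prod (partial_x a p) (b p)"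
  using has_vector_derivative[OF has_vector_derivative_partial_x[of a "fst p" "snd p"]
      has_vector_derivative_partial_x[of b "fst p" "snd p"]] assms
  by (simp add: partial_x_def vector_derivative_at)

lemma (in bounded_bilinear) partial_y:
  assumes "a differentiable at p" "b differentiable at p"
  shows "partial_y (\<lambda>q. prod (a q) (b q)) p = prod (a p) (partial_y b p) + prod (partial_y a p) (b p)"
  using has_vector_derivative[OF has_vector_derivative_partial_y[of a "fst p" "snd p"]
      has_vector_derivative_partial_y[of b "fst p" "snd p"]] assms
  by (simp add: partial_y_def vector_derivative_at)

section \<open>Bivectors in dimension four\<close>

text \<open>A transposition flips the sign of a permutation. Writing index lists as functions on the
  four positions reduces each adjacent swap to a check at four points.\<close>

lemma eps_compose:
  assumes "\<tau> = Transposition.transpose c d" "c \<noteq> d"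
    and "(\<lambda>j::4. if j = 1 then i' else if j = 2 then k' else if j = 3 then l' else m') =
      (\<lambda>j. if j = 1 then i else if j = 2 then k else if j = 3 then l else m) \<circ> \<tau>"
  shows "eps i' k' l' m' = - eps i k l m"
proof -
  let ?s = "\<lambda>j::4. if j = 1 then i else if j = 2 then k else if j = 3 then l else m"
  have \<tau>: "\<tau> permutes UNIV" "\<tau> \<circ> \<tau> = id"
    using assms(1) by (auto simp: permutes_swap_id)
  \<comment> \<open>As \<tau> is an involution, both index maps are permutations or neither is; in
    the latter case both symbols are 0.\<close>
  have iff: "?s \<circ> \<tau> permutes UNIV \<longleftrightarrow> ?s permutes UNIV"
    using permutes_compose[OF \<tau>(1), of ?s] permutes_compose[OF \<tau>(1), of "?s \<circ> \<tau>"] \<tau>(2)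
    by (auto simp only: comp_assoc comp_id)
  have "sign (?s \<circ> \<tau>) = - sign ?s" if "?s permutes UNIV"
    using that \<tau> assms(1,2) by (simp add: sign_compose sign_swap_id permutes_imp_permutation[of UNIV])
  then show ?thesis
    unfolding eps_def Let_def assms(3) iff by auto
qed

lemma eps_swap12: "eps k i l m = - eps i k l m"
  by (rule eps_compose[OF refl, of 1 2]) (simp_all add: fun_eq_iff forall_4 Transposition.transpose_def)

lemma eps_swap23: "eps i l k m = - eps i k l m"
  by (rule eps_compose[OF refl, of 2 3]) (simp_all add: fun_eq_iff forall_4 Transposition.transpose_def)

lemma eps_swap34: "eps i k m l = - eps i k l m"
  by (rule eps_compose[OF refl, of 3 4]) (simp_all add: fun_eq_iff forall_4 Transposition.transpose_def)

text \<open>Swapping two equal indices changes nothing, yet negates the symbol.\<close>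

lemma eps_adjacent_eq: "eps i i l m = 0" "eps i k k m = 0" "eps i k l l = 0"
  using eps_swap12[of i i l m] eps_swap23[of i k k m] eps_swap34[of i k l l] by simp_all

text \<open>As rewrite rules these bubble-sort numeral indices, so that every value of \<^const>\<open>eps\<close> is computed.\<close>

lemmas eps_sort =
  eps_swap12[of 2 1] eps_swap12[of 3 1] eps_swap12[of 4 1]
  eps_swap12[of 3 2] eps_swap12[of 4 2] eps_swap12[of 4 3]
  eps_swap23[of _ 2 1] eps_swap23[of _ 3 1] eps_swap23[of _ 4 1]
  eps_swap23[of _ 3 2] eps_swap23[of _ 4 2] eps_swap23[of _ 4 3]
  eps_swap34[of _ _ 2 1] eps_swap34[of _ _ 3 1] eps_swap34[of _ _ 4 1]
  eps_swap34[of _ _ 3 2] eps_swap34[of _ _ 4 2] eps_swap34[of _ _ 4 3]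
  eps_adjacent_eq eps_1234

lemma star_star_wedge: "star (star (wedge a b)) = wedge a b"
  by (simp add: vec_eq_iff forall_4 star_def wedge_def sum_4 eps_sort)
     (simp add: field_simps)

text \<open>The product a_l a_k is symmetric in l and k, while the symbol is alternating, so the
  contraction cancels.\<close>

lemma star_wedge_mult_left: "star (wedge a b) *v a = 0"
  by (simp add: vec_eq_iff forall_4 star_def wedge_def sum_4 eps_sort matrix_vector_mult_def)
     (simp add: field_simps)

lemma star_wedge_mult_right: "star (wedge a b) *v b = 0"
  by (simp add: vec_eq_iff forall_4 star_def wedge_def sum_4 eps_sort matrix_vector_mult_def)
     (simp add: field_simps)

lemma wedge_mult: "wedge a b *v c = (b \<bullet> c) *\<^sub>R a - (a \<bullet> c) *\<^sub>R b"
  by (simp add: vec_eq_iff forall_4 sum_4 wedge_def matrix_vector_mult_def inner_vec_def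
      algebra_simps)

lemma bounded_bilinear_wedge: "bounded_bilinear wedge"
  by (rule bilinear_conv_bounded_bilinear[THEN iffD1])
     (auto simp: bilinear_def wedge_def vec_eq_iff algebra_simps intro!: linearI)

lemma linear_star: "linear star"
  by (auto simp: star_def vec_eq_iff sum.distrib sum_distrib_left algebra_simps intro!: linearI)

text \<open>Lets the product rule differentiate the right-hand sides of the map directly.\<close>

lemma bounded_bilinear_star_wedge: "bounded_bilinear (\<lambda>a b. star (wedge a b))"
  using bounded_bilinear_wedge linear_star
  by (auto simp: bilinear_def intro: linear_compose[of _ star, unfolded o_def]
      simp flip: bilinear_conv_bounded_bilinear)

interpretation wedge: bounded_bilinear wedge
  by (rule bounded_bilinear_wedge)

lemmas star_linear = linear_0[OF linear_star] linear_add[OF linear_star] linear_diff[OF linear_star]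
  linear_neg[OF linear_star] linear_scale[OF linear_star]

lemma wedge_self [simp]: "wedge a a = 0"
  by (simp add: wedge_def vec_eq_iff)

lemma wedge_commute: "wedge b a = - wedge a b"
  by (simp add: wedge_def vec_eq_iff)

text \<open>\<open>star\<close> is its own inverse on these bivectors, so it can be stripped from an
  equation with 0.\<close>

lemma star_wedge_eq_0_iff: "star (wedge a b) = 0 \<longleftrightarrow> wedge a b = 0"
  by (metis star_star_wedge star_linear(1))

text \<open>Contracting with \<open>a\<close> gives <b,a> a = <a,a> b, which is solved for
  \<open>b\<close>.\<close>

lemma wedge_eq_0D:
  assumes "wedge a b = 0" "a \<noteq> 0"
  obtains c where "b = c *\<^sub>R a"
proof -
  have "(b \<bullet> a) *\<^sub>R a = (a \<bullet> a) *\<^sub>R b"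
    using wedge_mult[of a b a] assms(1) by simp
  moreover have "b = inverse (a \<bullet> a) *\<^sub>R (a \<bullet> a) *\<^sub>R b"
    using assms(2) by simp
  ultimately have "b = (inverse (a \<bullet> a) * (b \<bullet> a)) *\<^sub>R a"
    by (metis scaleR_scaleR)
  then show thesis by (rule that)
qed

text \<open>The right-hand side annihilates \<open>n\<close> and \<open>m\<close>; contracting the
  left-hand side with them leaves linear relations between \<open>a\<close> and
  \<open>b\<close>.\<close>

lemma wedge_eq_star_wedge_orthogonal:
  assumes eq: "wedge a b = star (wedge n m)" and "a \<noteq> 0" "a \<bullet> n = 0" "wedge n m \<noteq> 0"
  shows "b \<bullet> n = 0" "a \<bullet> m = 0" "b \<bullet> m = 0"
proof -
  have "(b \<bullet> n) *\<^sub>R a - (a \<bullet> n) *\<^sub>R b = 0"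
    by (metis eq star_wedge_mult_left wedge_mult)
  then show "b \<bullet> n = 0" using assms by simp
  have 1: "(b \<bullet> m) *\<^sub>R a = (a \<bullet> m) *\<^sub>R b"
    by (metis eq star_wedge_mult_right wedge_mult eq_iff_diff_eq_0)
  show 2: "a \<bullet> m = 0"
  proof (rule ccontr)
    assume "a \<bullet> m \<noteq> 0"
    \<comment> \<open>Otherwise \<open>b\<close> would be a multiple of \<open>a\<close>, making
      both sides of \<open>eq\<close> vanish.\<close>
    have "(a \<bullet> m) *\<^sub>R wedge a b = 0"
      using 1 by (metis wedge.scaleR_right wedge_self scaleR_zero_right)
    then show False
      using \<open>a \<bullet> m \<noteq> 0\<close> assms star_wedge_eq_0_iff by simp
  qed
  show "b \<bullet> m = 0" using 1 2 \<open>a \<noteq> 0\<close> by simp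
qed

text \<open>The hyperplane orthogonal to \<open>n\<close> has dimension 3, so three independent
  vectors in it span it.\<close>

lemma orthogonal_in_span3:
  fixes n u v w d :: "real ^ 4"
  assumes "n \<noteq> 0" "n \<bullet> u = 0" "n \<bullet> v = 0" "n \<bullet> w = 0" "n \<bullet> d = 0"
    and "distinct [u, v, w]" "independent {u, v, w}"
  obtains a b c where "d = a *\<^sub>R v + b *\<^sub>R w + c *\<^sub>R u"
proof -
  have "{x. n \<bullet> x = 0} \<subseteq> span {u, v, w}"
    by (rule card_ge_dim_independent) (use assms in \<open>auto simp: dim_hyperplane\<close>)
  then have "d \<in> span {u, v, w}" using assms by auto
  then obtain c a b where "d - c *\<^sub>R u - a *\<^sub>R v - b *\<^sub>R w = 0"
    by (auto simp: span_insert)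
  then have "d = a *\<^sub>R v + b *\<^sub>R w + c *\<^sub>R u" by (simp add: algebra_simps)
  then show thesis by (rule that)
qed

text \<open>\<open>independent\<close> concerns a set and cannot see repeated vectors; adding
  distinctness makes it the usual condition on coefficients.\<close>

lemma independent3_iff:
  fixes u v w :: "'a::real_vector"
  shows "distinct [u, v, w] \<and> independent {u, v, w} \<longleftrightarrow>
    (\<forall>a b c. a *\<^sub>R u + b *\<^sub>R v + c *\<^sub>R w = 0 \<longrightarrow> a = 0 \<and> b = 0 \<and> c = 0)" (is "?L \<longleftrightarrow> ?R")
proof
  assume L: ?L
  show ?R
  proof (intro allI impI)
    fix a b c :: real
    define \<phi> where "\<phi> = (\<lambda>z::'a. if z = u then a else if z = v then b else c)"
    assume "a *\<^sub>R u + b *\<^sub>R v + c *\<^sub>R w = 0"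
    then have "(\<Sum>z\<in>{u, v, w}. \<phi> z *\<^sub>R z) = 0"
      using L by (auto simp: \<phi>_def algebra_simps)
    then have "\<forall>z\<in>{u, v, w}. \<phi> z = 0"
      using L independentD[of "{u, v, w}" "{u, v, w}" \<phi>] by blast
    then show "a = 0 \<and> b = 0 \<and> c = 0"
      using L by (auto simp: \<phi>_def)
  qed
next
  assume R: ?R
  have "u \<noteq> v" using R[rule_format, of 1 "-1" 0] by auto
  moreover have "u \<noteq> w" using R[rule_format, of 1 0 "-1"] by auto
  moreover have "v \<noteq> w" using R[rule_format, of 0 1 "-1"] by auto
  moreover have "independent {u, v, w}"
  proof (rule independent_if_scalars_zero)
    fix \<phi> and z :: 'a assume "(\<Sum>z\<in>{u, v, w}. \<phi> z *\<^sub>R z) = 0" "z \<in> {u, v, w}"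
    then show "\<phi> z = 0"
      using R[rule_format, of "\<phi> u" "\<phi> v" "\<phi> w"] \<open>u \<noteq> v\<close> \<open>u \<noteq> w\<close> \<open>v \<noteq> w\<close>
      by (auto simp: algebra_simps)
  qed simp
  ultimately show ?L by auto
qed

section \<open>The elliptic Lelieuvre map\<close>

theorem theorem3p3:
  fixes D :: "(real \<times> real) set" and f \<nu> :: "real \<times> real \<Rightarrow> real ^ 4"
  assumes "open D"
    and "smooth_on D f" and "smooth_on D \<nu>"
    and "\<forall>p\<in>D. f p \<noteq> 0" and "\<forall>p\<in>D. \<nu> p \<noteq> 0"
    and "\<forall>p\<in>D. f p \<bullet> \<nu> p = 0"
    and "elliptic_lelieuvre D f \<nu>"
    and "\<forall>p\<in>D. distinct [\<nu> p, partial_x \<nu> p, partial_y \<nu> p] \<and>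
                independent {\<nu> p, partial_x \<nu> p, partial_y \<nu> p}"
  shows "\<exists>U V W C U' V' W' C' :: real \<times> real \<Rightarrow> real. \<forall>p\<in>D.
    partial_y (partial_x \<nu>) p =
      U p *\<^sub>R partial_x \<nu> p + V p *\<^sub>R partial_y \<nu> p + W p *\<^sub>R \<nu> p \<and>
    partial_y (partial_y \<nu>) p - partial_x (partial_x \<nu>) p =
      (- 2 * V' p) *\<^sub>R partial_x \<nu> p + (2 * U' p) *\<^sub>R partial_y \<nu> p + C p *\<^sub>R \<nu> p \<and>
    partial_y (partial_x f) p =
      U' p *\<^sub>R partial_x f p + V' p *\<^sub>R partial_y f p + W' p *\<^sub>R f p \<and>
    partial_y (partial_y f) p - partial_x (partial_x f) p =
      (- 2 * V p) *\<^sub>R partial_x f p + (2 * U p) *\<^sub>R partial_y f p + C' p *\<^sub>R f p"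
proof -
  have C2: "Ck_on (Suc (Suc 0)) D f" "Ck_on (Suc (Suc 0)) D \<nu>"
    using assms(2,3) unfolding smooth_on_def by blast+
  have diff: "f differentiable at p" "partial_x f differentiable at p" "partial_y f differentiable at p"
    "\<nu> differentiable at p" "partial_x \<nu> differentiable at p" "partial_y \<nu> differentiable at p"
    if "p \<in> D" for p
    using C2 that differentiable_on_eq_differentiable_at[OF \<open>open D\<close>] by auto
  \<comment> \<open>The minus sign goes into the second factor, giving both equations the shape used
    in \<open>wedge_eq_star_wedge_orthogonal\<close>.\<close>
  have eqx: "wedge (f p) (partial_x f p) = star (wedge (\<nu> p) (- partial_y \<nu> p))"
    and eqy: "wedge (f p) (partial_y f p) = star (wedge (\<nu> p) (partial_x \<nu> p))" if "p \<in> D" for p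
    using assms(7) that by (auto simp: elliptic_lelieuvre_def wedge.minus_right star_linear)
  have ind: "a = 0 \<and> b = 0 \<and> c = 0"
    if "p \<in> D" "a *\<^sub>R \<nu> p + b *\<^sub>R partial_x \<nu> p + c *\<^sub>R partial_y \<nu> p = 0" for p a b c
    using assms(8) that independent3_iff by blast
  \<comment> \<open>\<open>\<nu>_x\<close> and \<open>\<nu>_y\<close> are independent modulo \<nu>,
    and wedging with \<nu> kills only its multiples.\<close>
  have wedge_\<nu>: "b = 0 \<and> c = 0"
    if p: "p \<in> D" and 0: "wedge (\<nu> p) (b *\<^sub>R partial_x \<nu> p + c *\<^sub>R partial_y \<nu> p) = 0" for p b c
  proof -
    obtain a where "b *\<^sub>R partial_x \<nu> p + c *\<^sub>R partial_y \<nu> p = a *\<^sub>R \<nu> p"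
      using wedge_eq_0D[OF 0] p assms(5) by blast
    then show ?thesis using ind[of p "-a" b c] p by (simp add: algebra_simps)
  qed
  have ne: "wedge (\<nu> p) (- partial_y \<nu> p) \<noteq> 0" "wedge (\<nu> p) (partial_x \<nu> p) \<noteq> 0" if "p \<in> D" for p
    using wedge_\<nu>[of p 0 "-1"] wedge_\<nu>[of p 1 0] that by auto
  have orth: "f p \<bullet> \<nu> p = 0" "partial_x f p \<bullet> \<nu> p = 0" "partial_y f p \<bullet> \<nu> p = 0"
    "f p \<bullet> partial_x \<nu> p = 0" "f p \<bullet> partial_y \<nu> p = 0"
    "partial_x f p \<bullet> partial_y \<nu> p = 0" "partial_y f p \<bullet> partial_x \<nu> p = 0" if "p \<in> D" for p
    using wedge_eq_star_wedge_orthogonal[OF eqx] wedge_eq_star_wedge_orthogonal[OF eqy]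
      assms(4,6) ne that by auto
  \<comment> \<open>It suffices to find real coefficients at each point; choice turns them into
    functions.\<close>
  have "\<exists>U V W C U' V' W' C' :: real.
    partial_y (partial_x \<nu>) p = U *\<^sub>R partial_x \<nu> p + V *\<^sub>R partial_y \<nu> p + W *\<^sub>R \<nu> p \<and>
    partial_y (partial_y \<nu>) p - partial_x (partial_x \<nu>) p =
      (- 2 * V') *\<^sub>R partial_x \<nu> p + (2 * U') *\<^sub>R partial_y \<nu> p + C *\<^sub>R \<nu> p \<and>
    partial_y (partial_x f) p = U' *\<^sub>R partial_x f p + V' *\<^sub>R partial_y f p + W' *\<^sub>R f p \<and>
    partial_y (partial_y f) p - partial_x (partial_x f) p =
      (- 2 * V) *\<^sub>R partial_x f p + (2 * U) *\<^sub>R partial_y f p + C' *\<^sub>R f p"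
    if p: "p \<in> D" for p
  proof -
    note inner_partial = bounded_bilinear.partial_y[OF bounded_bilinear_inner]
    \<comment> \<open>The product rule adds <f_y, nu_x> here and <f_x, nu_y> in the next identity;
      both vanish by \<open>orth\<close>.\<close>
    have "partial_y (\<lambda>q. f q \<bullet> partial_x \<nu> q) p = partial_y (\<lambda>_. 0) p"
      by (rule partial_y_cong[OF \<open>open D\<close> p]) (simp add: orth)
    then have orth_\<nu>xy: "f p \<bullet> partial_y (partial_x \<nu>) p = 0"
      using orth p diff by (simp add: inner_partial partial_y_def[of "\<lambda>_. 0"])
    have "partial_y (\<lambda>q. partial_x f q \<bullet> \<nu> q) p = partial_y (\<lambda>_. 0) p"
      by (rule partial_y_cong[OF \<open>open D\<close> p]) (simp add: orth)
    then have orth_fxy: "partial_y (partial_x f) p \<bullet> \<nu> p = 0"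
      using orth p diff by (simp add: inner_partial partial_y_def[of "\<lambda>_. 0"])

    \<comment> \<open>Independence of f, f_x, f_y is carried over by the map: wedging a relation
      with f yields nu ^ (c nu_x - b nu_y) = 0, so b = c = 0, and then a f = 0.\<close>
    have "a = 0 \<and> b = 0 \<and> c = 0"
      if 0: "a *\<^sub>R f p + b *\<^sub>R partial_x f p + c *\<^sub>R partial_y f p = 0" for a b c
    proof -
      have "wedge (f p) (a *\<^sub>R f p + b *\<^sub>R partial_x f p + c *\<^sub>R partial_y f p) =
          star (wedge (\<nu> p) (c *\<^sub>R partial_x \<nu> p + (- b) *\<^sub>R partial_y \<nu> p))"
        using p by (simp add: wedge.add_right wedge.scaleR_right wedge.minus_right eqx eqy
            wedge.diff_right star_linear)
      then have "wedge (\<nu> p) (c *\<^sub>R partial_x \<nu> p + (- b) *\<^sub>R partial_y \<nu> p) = 0"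
        by (simp only: 0 wedge.zero_right flip: star_wedge_eq_0_iff)
      then have "b = 0 \<and> c = 0" using wedge_\<nu>[OF p, of c "- b"] by simp
      then show ?thesis using 0 assms(4) p by simp
    qed
    then have ind_f: "distinct [f p, partial_x f p, partial_y f p]"
        "independent {f p, partial_x f p, partial_y f p}"
      using independent3_iff by blast+

    obtain U V W where \<nu>xy: "partial_y (partial_x \<nu>) p = U *\<^sub>R partial_x \<nu> p + V *\<^sub>R partial_y \<nu> p + W *\<^sub>R \<nu> p"
      using orthogonal_in_span3[of "f p" "\<nu> p" "partial_x \<nu> p" "partial_y \<nu> p"]
        orth orth_\<nu>xy p assms(4,8) by metis
    obtain U' V' W' where fxy: "partial_y (partial_x f) p = U' *\<^sub>R partial_x f p + V' *\<^sub>R partial_y f p + W' *\<^sub>R f p"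
      using orthogonal_in_span3[of "\<nu> p" "f p" "partial_x f p" "partial_y f p"]
        orth orth_fxy ind_f p assms(5) by (metis inner_commute)

    have comm: "partial_x (partial_y f) p = partial_y (partial_x f) p"
      "partial_x (partial_y \<nu>) p = partial_y (partial_x \<nu>) p"
      using partial_x_partial_y C2 \<open>open D\<close> p by blast+
    have eqy': "\<forall>q\<in>D. wedge (f q) (partial_y f q) = star (wedge (\<nu> q) (partial_x \<nu> q))"
      using eqy by blast
    \<comment> \<open>Here the sign is absorbed by exchanging the factors, so differentiation in y
      produces the vanishing term nu_y ^ nu_y.\<close>
    have eqx': "\<forall>q\<in>D. wedge (f q) (partial_x f q) = star (wedge (partial_y \<nu> q) (\<nu> q))"
      using eqx by (simp add: wedge.minus_right wedge_commute[of "partial_y \<nu> _"])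
    note wedge_partial = bounded_bilinear.partial_x[OF bounded_bilinear_wedge]
      bounded_bilinear.partial_y[OF bounded_bilinear_wedge]
      bounded_bilinear.partial_x[OF bounded_bilinear_star_wedge]
      bounded_bilinear.partial_y[OF bounded_bilinear_star_wedge]
    have dy_eqx: "wedge (f p) (partial_y (partial_x f) p) + wedge (partial_y f p) (partial_x f p) =
        star (wedge (partial_y (partial_y \<nu>) p) (\<nu> p))"
      using partial_y_cong[OF \<open>open D\<close> p eqx'] diff[OF p] by (simp add: wedge_partial star_linear)
    have dx_eqy: "wedge (f p) (partial_y (partial_x f) p) + wedge (partial_x f p) (partial_y f p) =
        star (wedge (\<nu> p) (partial_x (partial_x \<nu>) p))"
      using partial_x_cong[OF \<open>open D\<close> p eqy'] diff[OF p] by (simp add: wedge_partial star_linear comm)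
    have dx_eqx: "wedge (f p) (partial_x (partial_x f) p) =
        star (wedge (partial_y \<nu> p) (partial_x \<nu> p)) + star (wedge (partial_y (partial_x \<nu>) p) (\<nu> p))"
      using partial_x_cong[OF \<open>open D\<close> p eqx'] diff[OF p] by (simp add: wedge_partial comm)
    have dy_eqy: "wedge (f p) (partial_y (partial_y f) p) =
        star (wedge (\<nu> p) (partial_y (partial_x \<nu>) p)) + star (wedge (partial_y \<nu> p) (partial_x \<nu> p))"
      using partial_y_cong[OF \<open>open D\<close> p eqy'] diff[OF p] by (simp add: wedge_partial)

    note linear_simps = wedge.add_right wedge.diff_right wedge.scaleR_right wedge.minus_right
      star_linear
    have star\<nu>y: "star (wedge (\<nu> p) (partial_y \<nu> p)) = - wedge (f p) (partial_x f p)"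
      using eqx[OF p] by (simp add: linear_simps)
    \<comment> \<open>Adding the two derivatives cancels f_x ^ f_y against f_y ^ f_x; this is the
      source of the factor 2.\<close>
    have "2 *\<^sub>R wedge (f p) (partial_y (partial_x f) p) =
        star (wedge (\<nu> p) (partial_x (partial_x \<nu>) p)) - star (wedge (\<nu> p) (partial_y (partial_y \<nu>) p))"
      using arg_cong2[OF dy_eqx dx_eqy, of "(+)"]
      by (simp add: scaleR_2 wedge_commute[of "partial_y f p"] wedge_commute[of _ "\<nu> p"] star_linear)
    \<comment> \<open>The \<open>W'\<close> term drops since f ^ f = 0. The map turns f ^ f_x into
      -*(nu ^ nu_y) and f ^ f_y into *(nu ^ nu_x), so \<open>U'\<close> multiplies nu_y and
      \<open>V'\<close> multiplies nu_x.\<close>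
    then have "star (wedge (\<nu> p) (partial_y (partial_y \<nu>) p - partial_x (partial_x \<nu>) p -
        ((- 2 * V') *\<^sub>R partial_x \<nu> p + (2 * U') *\<^sub>R partial_y \<nu> p))) = 0"
      by (simp add: fxy linear_simps star\<nu>y algebra_simps flip: eqy[OF p])
    then obtain C where C: "partial_y (partial_y \<nu>) p - partial_x (partial_x \<nu>) p -
        ((- 2 * V') *\<^sub>R partial_x \<nu> p + (2 * U') *\<^sub>R partial_y \<nu> p) = C *\<^sub>R \<nu> p"
      using star_wedge_eq_0_iff wedge_eq_0D assms(5) p by metis
    \<comment> \<open>Subtraction cancels the common term *(nu_y ^ nu_x), and the two terms in nu_xy
      add up.\<close>
    have "wedge (f p) (partial_y (partial_y f) p) - wedge (f p) (partial_x (partial_x f) p) =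
        2 *\<^sub>R star (wedge (\<nu> p) (partial_y (partial_x \<nu>) p))"
      by (simp add: dx_eqx dy_eqy scaleR_2 wedge_commute[of _ "\<nu> p"] star_linear)
    \<comment> \<open>The map is read in the other direction: *(nu ^ nu_x) becomes f ^ f_y and *(nu
      ^ nu_y) becomes -f ^ f_x, whence 2U and -2V.\<close>
    then have "wedge (f p) (partial_y (partial_y f) p - partial_x (partial_x f) p -
        ((- 2 * V) *\<^sub>R partial_x f p + (2 * U) *\<^sub>R partial_y f p)) = 0"
      by (simp add: \<nu>xy linear_simps star\<nu>y algebra_simps flip: eqy[OF p])
    then obtain C' where C': "partial_y (partial_y f) p - partial_x (partial_x f) p -
        ((- 2 * V) *\<^sub>R partial_x f p + (2 * U) *\<^sub>R partial_y f p) = C' *\<^sub>R f p"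
      using wedge_eq_0D assms(4) p by metis
    show ?thesis
      using \<nu>xy fxy C C' by (metis diff_eq_eq add.commute)
  qed
  then show ?thesis by metis
qed

end
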